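(* Let $\mathcal{H}$ be a real Hilbert space, let $f\in\Gamma_0(\mathcal{H})$ be Legendre, let $m\ge 1$, and let $\mathcal{S}=\{p_0,p_1,\dots,p_m\}\subseteq\operatorname{dom} f$. Suppose that $\overrightarrow{E}_f(\mathcal{S})\neq\varnothing$ and let $y\in\overrightarrow{E}_f(\mathcal{S})$. Set $M=\operatorname{span}\{p_1-p_0,\dots,p_m-p_0\}$. Then the following hold. (i) $\overrightarrow{CC}^{ps}_f(\mathcal{S})=\nabla f^*(\operatorname{aff}(\mathcal{S}))\cap\operatorname{int}\operatorname{dom} f\cap\nabla f^*\big(\nabla f(y)+M^{\perp}\big)$. (ii) Suppose that $P_{\operatorname{aff}(\mathcal{S})}(\nabla f(y))\in\operatorname{int}\operatorname{dom} f^*$ (for example, $\operatorname{aff}(\mathcal{S})\subseteq\operatorname{int}\operatorname{dom} f^*$ or $\operatorname{dom} f^*=\mathcal{H}$). Then $\overrightarrow{CC}^{ps}_f(\mathcal{S})=\big\{\nabla f^*\big(P_{\operatorname{aff}(\mathcal{S})}(\nabla f(y))\big)\big\}$.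
   Context: $\Gamma_0(\mathcal{H})$ is the set of proper closed convex functions $\mathcal{H}\to\,]-\infty,+\infty]$; $f^*$ is the Fenchel conjugate; $\operatorname{aff}$ denotes affine hull; $P_C$ is the Euclidean (Hilbert-norm) projector onto $C$. $f\in\Gamma_0(\mathcal{H})$ is Legendre if it is essentially smooth ($\operatorname{dom}\partial f=\operatorname{int}\operatorname{dom} f\neq\varnothing$, $f$ is Gâteaux differentiable on $\operatorname{int}\operatorname{dom} f$, and $\|\nabla f(x_k)\|\to+\infty$ for every sequence $(x_k)$ in $\operatorname{int}\operatorname{dom} f$ converging to a point of $\operatorname{bd}\operatorname{dom} f$) and essentially strictly convex ($(\partial f)^{-1}$ is locally bounded on its domain and $f$ is strictly convex on every convex subset of $\operatorname{dom}\partial f$). If $f$ is Legendre then so is $f^*$, and $\nabla f:\operatorname{int}\operatorname{dom} f\to\operatorname{int}\operatorname{dom} f^*$ is a bijection with inverse $\nabla f^*$. For a set $C$, $\nabla f^*(C)$ means $\{\nabla f^*(u):u\in C\cap\operatorname{int}\operatorname{dom} f^*\}$. The Bregman distance is $D_f(x,y)=f(x)-f(y)-\langle\nabla f(y),x-y\rangle$ if $y\in\operatorname{int}\operatorname{dom} f$, and $+\infty$ otherwise. $\overrightarrow{E}_f(\mathcal{S})=\{y\in\operatorname{int}\operatorname{dom} f:\ D_f(p_0,y)=D_f(p_1,y)=\cdots=D_f(p_m,y)\}$. The forward Bregman pseudo-circumcenter set of $\mathcal{S}$ is $\overrightarrow{CC}^{ps}_f(\mathcal{S})=\nabla f^*(\operatorname{aff}(\mathcal{S}))\cap\overrightarrow{E}_f(\mathcal{S})$.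 *)

theory Defs
  imports "HOL-Analysis.Analysis"
begin

text \<open>
  Real Hilbert spaces are types of sort \<open>{real_inner, complete_space}\<close>, and functions into
  \<open>]-\<infinity>, +\<infinity>]\<close> are functions into \<^typ>\<open>ereal\<close> that never take the value \<open>-\<infinity>\<close>.
\<close>

definition edom :: "('a \<Rightarrow> ereal) \<Rightarrow> 'a set"
  where "edom f = {x. f x < \<infinity>}"

definition eepigraph :: "('a \<Rightarrow> ereal) \<Rightarrow> ('a \<times> real) set"
  where "eepigraph f = {(x, r). f x \<le> ereal r}"

definition Gamma0 :: "('a::{real_inner,complete_space} \<Rightarrow> ereal) set"
  where "Gamma0 =
    {f. (\<forall>x. f x \<noteq> -\<infinity>) \<and> edom f \<noteq> {} \<and> closed (eepigraph f) \<and> convex (eepigraph f)}"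

definition fenchel_conj :: "('a::real_inner \<Rightarrow> ereal) \<Rightarrow> 'a \<Rightarrow> ereal"
  where "fenchel_conj f u = (SUP x. ereal (x \<bullet> u) - f x)"

text \<open>For proper \<open>f\<close> this set is empty as soon as \<open>f x = \<infinity>\<close>.\<close>

definition subdiff :: "('a::real_inner \<Rightarrow> ereal) \<Rightarrow> 'a \<Rightarrow> 'a set"
  where "subdiff f x = {u. \<forall>z. f x + ereal ((z - x) \<bullet> u) \<le> f z}"

definition dom_subdiff :: "('a::real_inner \<Rightarrow> ereal) \<Rightarrow> 'a set"
  where "dom_subdiff f = {x. subdiff f x \<noteq> {}}"

definition inv_subdiff :: "('a::real_inner \<Rightarrow> ereal) \<Rightarrow> 'a \<Rightarrow> 'a set"
  where "inv_subdiff f u = {x. u \<in> subdiff f x}"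

text \<open>
  The Gateaux derivative is the continuous linear functional \<open>h \<mapsto> g \<bullet> h\<close>, represented by its
  gradient \<open>g\<close>.  At an interior point of the domain of a proper function,
  \<^const>\<open>real_of_ereal\<close> only sees finite values for small \<open>t\<close>.
\<close>

definition has_gateaux_gradient :: "('a::real_inner \<Rightarrow> ereal) \<Rightarrow> 'a \<Rightarrow> 'a \<Rightarrow> bool"
  where "has_gateaux_gradient f x g \<longleftrightarrow>
    x \<in> interior (edom f) \<and>
    (\<forall>h. ((\<lambda>t::real. real_of_ereal (f (x + t *\<^sub>R h))) has_real_derivative (g \<bullet> h)) (at 0))"

definition grad :: "('a::real_inner \<Rightarrow> ereal) \<Rightarrow> 'a \<Rightarrow> 'a"
  where "grad f x = (THE g. has_gateaux_gradient f x g)"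

definition essentially_smooth :: "('a::real_inner \<Rightarrow> ereal) \<Rightarrow> bool"
  where "essentially_smooth f \<longleftrightarrow>
    dom_subdiff f = interior (edom f) \<and> interior (edom f) \<noteq> {} \<and>
    (\<forall>x\<in>interior (edom f). \<exists>g. has_gateaux_gradient f x g) \<and>
    (\<forall>(X :: nat \<Rightarrow> 'a) z. (\<forall>k. X k \<in> interior (edom f)) \<longrightarrow> z \<in> frontier (edom f) \<longrightarrow>
        X \<longlonglongrightarrow> z \<longrightarrow> filterlim (\<lambda>k. norm (grad f (X k))) at_top sequentially)"

definition strictly_convex_on :: "'a::real_vector set \<Rightarrow> ('a \<Rightarrow> ereal) \<Rightarrow> bool"
  where "strictly_convex_on C f \<longleftrightarrow>
    (\<forall>x\<in>C. \<forall>z\<in>C. \<forall>t::real. x \<noteq> z \<longrightarrow> 0 < t \<longrightarrow> t < 1 \<longrightarrow>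
        f ((1 - t) *\<^sub>R x + t *\<^sub>R z) < ereal (1 - t) * f x + ereal t * f z)"

definition essentially_strictly_convex :: "('a::real_inner \<Rightarrow> ereal) \<Rightarrow> bool"
  where "essentially_strictly_convex f \<longleftrightarrow>
    (\<forall>u. inv_subdiff f u \<noteq> {} \<longrightarrow>
        (\<exists>e>0. bounded (\<Union>v\<in>ball u e. inv_subdiff f v))) \<and>
    (\<forall>C. convex C \<longrightarrow> C \<subseteq> dom_subdiff f \<longrightarrow> strictly_convex_on C f)"

definition legendre :: "('a::real_inner \<Rightarrow> ereal) \<Rightarrow> bool"
  where "legendre f \<longleftrightarrow> essentially_smooth f \<and> essentially_strictly_convex f"

definition bregman :: "('a::real_inner \<Rightarrow> ereal) \<Rightarrow> 'a \<Rightarrow> 'a \<Rightarrow> ereal"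
  where "bregman f x y =
    (if y \<in> interior (edom f) then f x - f y - ereal (grad f y \<bullet> (x - y)) else \<infinity>)"

text \<open>The set \<open>\<nabla>f\<^sup>*(C)\<close>: only the points of \<open>C\<close> in \<open>int dom f\<^sup>*\<close> are taken into account.\<close>

definition grad_conj_image :: "('a::real_inner \<Rightarrow> ereal) \<Rightarrow> 'a set \<Rightarrow> 'a set"
  where "grad_conj_image f C =
    grad (fenchel_conj f) ` (C \<inter> interior (edom (fenchel_conj f)))"

definition forward_equidistant :: "('a::real_inner \<Rightarrow> ereal) \<Rightarrow> 'a set \<Rightarrow> 'a set"
  where "forward_equidistant f S =
    {y \<in> interior (edom f). \<forall>p\<in>S. \<forall>q\<in>S. bregman f p y = bregman f q y}"

definition forward_pseudo_circumcenters :: "('a::real_inner \<Rightarrow> ereal) \<Rightarrow> 'a set \<Rightarrow> 'a set"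
  where "forward_pseudo_circumcenters f S =
    grad_conj_image f (affine hull S) \<inter> forward_equidistant f S"

text \<open>
  The library's \<^const>\<open>closest_point\<close> requires sort \<open>heine_borel\<close>, that is,
  finite dimension.
\<close>

definition hilbert_proj :: "'a::real_inner set \<Rightarrow> 'a \<Rightarrow> 'a"
  where "hilbert_proj C x = (THE c. c \<in> C \<and> (\<forall>z\<in>C. dist x c \<le> dist x z))"

end

theory Submission
  imports Defs
begin

text \<open>
  For a Legendre function, \<open>\<nabla>f\<close> and \<open>\<nabla>f\<^sup>*\<close> are mutually inverse, so \<open>x \<in> \<nabla>f\<^sup>*(C)\<close> just says that
  \<open>x \<in> int dom f\<close> and \<open>\<nabla>f x \<in> C\<close>. Subtracting two Bregman distances cancels \<open>f y\<close> and \<open>\<nabla>f y \<bullet> y\<close>;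
  hence \<open>x\<close> is equidistant together with \<open>y\<close> iff \<open>\<nabla>f x - \<nabla>f y\<close> is orthogonal to the direction space
  \<open>M\<close> of \<open>aff S\<close>. The projection of \<open>\<nabla>f y\<close> is the only point of \<open>aff S\<close> in \<open>\<nabla>f y + M\<^sup>\<bottom>\<close>.

  The inversion is obtained from the definitions of essential smoothness and essential strict
  convexity by minimizing \<open>f - (\<bullet>) u\<close>: the minimizers are the points of \<open>(\<partial>f)\<^sup>-\<^sup>1 u\<close>, existence for
  \<open>u \<in> int dom f\<^sup>*\<close> comes from coercivity, uniqueness from strict convexity, and weak continuity of
  the minimizer in \<open>u\<close> gives Gateaux differentiability of \<open>f\<^sup>*\<close>.
\<close>

section \<open>Finite values, subgradients and conjugates as real inequalities\<close>

lemma Gamma0_finite: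
  assumes "f \<in> Gamma0" "x \<in> edom f"
  obtains s where "f x = ereal s"
  using assms by (cases "f x") (auto simp: Gamma0_def edom_def)

lemma Gamma0_convex_bound:
  assumes "f \<in> Gamma0" "f x \<le> ereal a" "f z \<le> ereal b" "0 \<le> t" "t \<le> 1"
  shows "f ((1 - t) *\<^sub>R x + t *\<^sub>R z) \<le> ereal ((1 - t) * a + t * b)"
proof -
  have "convex (eepigraph f)" "(x, a) \<in> eepigraph f" "(z, b) \<in> eepigraph f"
    using assms by (auto simp: Gamma0_def eepigraph_def)
  then have "(1 - t) *\<^sub>R (x, a) + t *\<^sub>R (z, b) \<in> eepigraph f"
    using assms(4,5) unfolding convex_alt by blast
  then show ?thesis by (simp add: eepigraph_def)
qed

lemma convex_edom:
  assumes "f \<in> Gamma0"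
  shows "convex (edom f)"
  unfolding convex_alt
proof safe
  fix x z t
  assume *: "x \<in> edom f" "z \<in> edom f" "0 \<le> (t::real)" "t \<le> 1"
  obtain a b where "f x = ereal a" "f z = ereal b"
    using Gamma0_finite[OF assms] * by metis
  then have "f ((1 - t) *\<^sub>R x + t *\<^sub>R z) \<le> ereal ((1 - t) * a + t * b)"
    using Gamma0_convex_bound[OF assms] * by simp
  then show "(1 - t) *\<^sub>R x + t *\<^sub>R z \<in> edom f"
    unfolding edom_def using le_less_trans by fastforce
qed

text \<open>The subgradient inequality at a point of the domain forces \<open>f x\<close> to be
  finite; naming this value \<open>s\<close> keeps later arguments in real arithmetic.\<close>

lemma subdiff_iff:
  assumes "f \<in> Gamma0"
  shows "u \<in> subdiff f x \<longleftrightarrow> (\<exists>s. f x = ereal s \<and> (\<forall>z. ereal (s + (z - x) \<bullet> u) \<le> f z))"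
proof
  assume u: "u \<in> subdiff f x"
  from assms obtain w where w: "w \<in> edom f" by (auto simp: Gamma0_def)
  have "f x + ereal ((w - x) \<bullet> u) \<le> f w" using u by (auto simp: subdiff_def)
  then have "x \<in> edom f" using w by (cases "f x") (auto simp: edom_def)
  then obtain s where "f x = ereal s" using Gamma0_finite assms by metis
  then show "\<exists>s. f x = ereal s \<and> (\<forall>z. ereal (s + (z - x) \<bullet> u) \<le> f z)"
    using u by (auto simp: subdiff_def)
qed (auto simp: subdiff_def)

text \<open>This trades the supremum for affine minorants of \<open>f\<close> with slope
  \<open>u\<close>, the form in which the domain of the conjugate is handled below.\<close>

lemma fenchel_conj_le_iff:
  assumes "f \<in> Gamma0"
  shows "fenchel_conj f u \<le> ereal C \<longleftrightarrow> (\<forall>z. ereal (z \<bullet> u - C) \<le> f z)"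
proof -
  have "ereal (z \<bullet> u) - f z \<le> ereal C \<longleftrightarrow> ereal (z \<bullet> u - C) \<le> f z" for z
    using assms by (cases "f z") (auto simp: Gamma0_def)
  then show ?thesis by (simp add: fenchel_conj_def SUP_le_iff)
qed

lemma edom_fenchel_conj_iff:
  assumes "f \<in> Gamma0"
  shows "u \<in> edom (fenchel_conj f) \<longleftrightarrow> (\<exists>C. \<forall>z. ereal (z \<bullet> u - C) \<le> f z)"
proof -
  have "u \<in> edom (fenchel_conj f) \<longleftrightarrow> (\<exists>C. fenchel_conj f u \<le> ereal C)"
    by (cases "fenchel_conj f u") (auto simp: edom_def)
  then show ?thesis using fenchel_conj_le_iff[OF assms] by simp
qed

text \<open>The equality case of the Fenchel-Young inequality: the supremum is attained at
  \<open>x\<close>.\<close>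

lemma fenchel_conj_eq:
  assumes "f \<in> Gamma0" "x \<in> inv_subdiff f u"
  shows "fenchel_conj f u = ereal (x \<bullet> u - real_of_ereal (f x))"
proof -
  obtain s where s: "f x = ereal s" "\<And>z. ereal (s + (z - x) \<bullet> u) \<le> f z"
    using assms by (auto simp: inv_subdiff_def subdiff_iff)
  have "fenchel_conj f u \<le> ereal (x \<bullet> u - s)"
    using s(2) by (simp add: fenchel_conj_le_iff[OF assms(1)] inner_diff_left add_diff_eq add.commute diff_diff_eq2)
  moreover have "ereal (x \<bullet> u - s) \<le> fenchel_conj f u"
    unfolding fenchel_conj_def using s(1) by (intro SUP_upper2[of x]) auto
  ultimately show ?thesis using s by simp
qed

section \<open>Minima of convex functions through nested closed convex sets\<close>

text \<open>
  Almost-minimal-norm points of the sets form a Cauchy sequence by the parallelogram law. This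
  replaces weak compactness of bounded closed convex sets throughout.
\<close>

lemma nested_closed_convex_inter_nonempty:
  fixes C :: "nat \<Rightarrow> 'a::{real_inner,complete_space} set"
  assumes closed: "\<And>n. closed (C n)" and conv: "\<And>n. convex (C n)"
    and ne: "\<And>n. C n \<noteq> {}" and dec: "\<And>n. C (Suc n) \<subseteq> C n" and bdd: "bounded (C 0)"
  shows "(\<Inter>n. C n) \<noteq> {}"
proof -
  have anti: "C n \<subseteq> C m" if "m \<le> n" for m n
    using lift_Suc_antimono_le[of C, OF dec that] .
  \<comment> \<open>\<open>d n\<close> is the squared distance from the origin to
    \<open>C n\<close>: it increases as the sets shrink and is bounded, hence Cauchy.\<close>
  define d where "d n = (INF z\<in>C n. (norm z)\<^sup>2)" for n
  have below: "bdd_below ((\<lambda>z. (norm z)\<^sup>2) ` C n)" for n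
    by (rule bdd_belowI2[of _ 0]) simp
  have d_le: "d n \<le> (norm z)\<^sup>2" if "z \<in> C n" for n z
    unfolding d_def using below that by (rule cINF_lower)
  define r where "r n = inverse (real (Suc n))" for n
  have r: "r n > 0" "m \<le> n \<Longrightarrow> r n \<le> r m" for m n
    unfolding r_def by (auto intro!: le_imp_inverse_le)
  have "\<exists>z\<in>C n. (norm z)\<^sup>2 < d n + r n" for n
    using cINF_less_iff[OF ne below, of n "d n + r n"] r(1)[of n] by (auto simp: d_def)
  then obtain z where z: "\<And>n. z n \<in> C n" "\<And>n. (norm (z n))\<^sup>2 < d n + r n"
    by metis
  obtain B where B: "\<And>x. x \<in> C 0 \<Longrightarrow> norm x \<le> B"
    using bdd bounded_iff by metis
  have d_mono: "incseq d"
    unfolding incseq_def d_def using anti by (auto intro!: cINF_superset_mono ne below)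
  have "d n \<le> B\<^sup>2" for n :: nat
  proof -
    have "z n \<in> C 0" using anti[of 0 n] z(1) by auto
    then show ?thesis
      using d_le[OF z(1), of n] power_mono[OF B, of "z n" 2] by simp
  qed
  then obtain L where "d \<longlonglongrightarrow> L"
    using incseq_convergent[OF d_mono, of "B\<^sup>2"] by blast
  then have "Cauchy d" by (rule LIMSEQ_imp_Cauchy)
  have para: "(norm (z n - z m))\<^sup>2 \<le> 2 * (d m - d n) + 4 * r n" if "n \<le> m" for m n
  proof -
    \<comment> \<open>The midpoint of \<open>z n\<close> and \<open>z m\<close> lies in
      \<open>C n\<close>, so \<open>d n\<close> bounds its squared norm from below; the
      parallelogram law then leaves little room for \<open>z n - z m\<close>.\<close>
    have "z m \<in> C n" using anti that z(1) by auto
    then have "(1/2) *\<^sub>R z n + (1/2) *\<^sub>R z m \<in> C n"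
      using conv[of n] z(1)[of n] unfolding convex_def by simp
    from d_le[OF this] have "4 * d n \<le> (norm (z n + z m))\<^sup>2"
      by (simp flip: scaleR_add_right add: power2_eq_square)
    moreover have "(norm (z n - z m))\<^sup>2 + (norm (z n + z m))\<^sup>2 = 2 * (norm (z n))\<^sup>2 + 2 * (norm (z m))\<^sup>2"
      by (simp add: power2_norm_eq_inner inner_diff inner_add algebra_simps inner_commute)
    ultimately show ?thesis using z(2)[of n] z(2)[of m] r(2)[OF that] by argo
  qed
  have "Cauchy z"
  proof (rule metric_CauchyI)
    fix e :: real assume e: "e > 0"
    \<comment> \<open>With \<open>1/8\<close>, the bound \<open>2 * (d m - d n) + 4 * r n\<close>
      stays below 3/4 of the square of \<open>e\<close>.\<close>
    then have "e\<^sup>2 / 8 > 0" by simp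
    obtain N1 where N1: "\<And>m n. m \<ge> N1 \<Longrightarrow> n \<ge> N1 \<Longrightarrow> dist (d m) (d n) < e\<^sup>2 / 8"
      using \<open>Cauchy d\<close> \<open>e\<^sup>2/8 > 0\<close> unfolding Cauchy_def by metis
    obtain N2 where N2: "r N2 < e\<^sup>2 / 8"
      using reals_Archimedean[OF \<open>e\<^sup>2 / 8 > 0\<close>] by (auto simp: r_def)
    have *: "dist (z n) (z m) < e" if "n \<ge> max N1 N2" "n \<le> m" for m n
    proof -
      have "r n \<le> r N2" using that by (intro r) auto
      moreover have "\<bar>d m - d n\<bar> < e\<^sup>2 / 8"
        using N1[of m n] that by (auto simp: dist_real_def)
      ultimately have "(norm (z n - z m))\<^sup>2 < e\<^sup>2"
        using para[OF that(2)] N2 \<open>e\<^sup>2 / 8 > 0\<close> by argo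
      then show ?thesis using e by (simp add: dist_norm power2_less_imp_less)
    qed
    show "\<exists>M. \<forall>m\<ge>M. \<forall>n\<ge>M. dist (z m) (z n) < e"
      using * by (metis dist_commute nle_le)
  qed
  then obtain l where l: "z \<longlonglongrightarrow> l" using Cauchy_convergent convergent_def by blast
  have "l \<in> C n" for n
  proof (rule Lim_in_closed_set[OF closed _ _ l])
    show "eventually (\<lambda>k. z k \<in> C n) sequentially"
      using eventually_ge_at_top[of n] by eventually_elim (use anti z(1) in blast)
  qed simp
  then show ?thesis by blast
qed

lemma closed_sublevel:
  fixes h :: "'a::{real_inner,complete_space} \<Rightarrow> real"
  assumes "f \<in> Gamma0" "continuous_on UNIV h"
  shows "closed {z. f z \<le> ereal (h z)}"
proof -
  have "closed ((\<lambda>z. (z, h z)) -` eepigraph f)"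
    using assms by (intro closed_vimage) (auto simp: Gamma0_def intro!: continuous_intros)
  then show ?thesis by (simp add: eepigraph_def vimage_def)
qed

lemma convex_sublevel:
  assumes "f \<in> Gamma0" "concave_on UNIV h"
  shows "convex {z. f z \<le> ereal (h z)}"
  unfolding convex_alt
proof safe
  fix x z t
  assume *: "f x \<le> ereal (h x)" "f z \<le> ereal (h z)" "0 \<le> (t::real)" "t \<le> 1"
  have "f ((1 - t) *\<^sub>R x + t *\<^sub>R z) \<le> ereal ((1 - t) * h x + t * h z)"
    using Gamma0_convex_bound[OF assms(1)] * by simp
  also have "(1 - t) * h x + t * h z \<le> h ((1 - t) *\<^sub>R x + t *\<^sub>R z)"
    using assms(2) * by (simp add: concave_on_iff)
  finally show "f ((1 - t) *\<^sub>R x + t *\<^sub>R z) \<le> ereal (h ((1 - t) *\<^sub>R x + t *\<^sub>R z))" by simp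
qed

lemma concave_on_add_const:
  fixes h :: "'a::real_vector \<Rightarrow> real"
  assumes "concave_on UNIV h"
  shows "concave_on UNIV (\<lambda>z. h z + a)"
proof -
  have "u * (b + a) + v * (c + a) = u * b + v * c + a" if "u + v = 1" for u v b c :: real
  proof -
    have v: "v = 1 - u" using that by simp
    show ?thesis unfolding v by (simp add: algebra_simps)
  qed
  then show ?thesis using assms by (simp add: concave_on_iff)
qed

text \<open>Passes from approximate to exact solutions: the sets with slack
  \<open>1 / (n + 1)\<close>, cut with \<open>K\<close>, are nested, closed, convex and bounded, so
  they share a point.\<close>

lemma sublevel_attained:
  assumes "f \<in> Gamma0" "continuous_on UNIV h" "concave_on UNIV h"
    and K: "closed K" "convex K" "bounded K"
    and ne: "\<And>e. e > 0 \<Longrightarrow> \<exists>z\<in>K. f z \<le> ereal (h z + e)"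
  shows "\<exists>z\<in>K. f z \<le> ereal (h z)"
proof -
  define C where "C n = K \<inter> {z. f z \<le> ereal (h z + inverse (Suc n))}" for n
  have "(\<Inter>n. C n) \<noteq> {}"
  proof (rule nested_closed_convex_inter_nonempty)
    fix n
    show "closed (C n)" unfolding C_def
      by (intro closed_Int K closed_sublevel assms continuous_intros)
    have "concave_on UNIV (\<lambda>z. h z + inverse (Suc n))"
      using assms(3) by (rule concave_on_add_const)
    then show "convex (C n)" unfolding C_def
      by (intro convex_Int K convex_sublevel assms)
    show "C n \<noteq> {}" using ne[of "inverse (Suc n)"] by (auto simp: C_def)
    have "inverse (real (Suc (Suc n))) \<le> inverse (Suc n)"
      by (intro le_imp_inverse_le) auto
    then show "C (Suc n) \<subseteq> C n" 
      unfolding C_def by (auto elim!: order_trans)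
    show "bounded (C 0)" using K by (auto simp: C_def)
  qed
  then obtain z where z: "\<And>n. z \<in> C n" by blast
  have "f z \<le> ereal (h z)"
  proof (rule ereal_le_epsilon2)
    fix e :: real assume "e > 0"
    then obtain n where "inverse (Suc n) < e" using reals_Archimedean by blast
    moreover have "f z \<le> ereal (h z + inverse (Suc n))" using z[of n] by (auto simp: C_def)
    ultimately show "f z \<le> ereal (h z) + ereal e" by (auto elim!: order_trans)
  qed
  then show ?thesis using z by (auto simp: C_def)
qed

text \<open>The direct method for \<open>f - h\<close>: one bounded level set stands in for
  compactness, first to make the infimum finite and then to attain it.\<close>

lemma minimum_attained:
  assumes f: "f \<in> Gamma0" and h: "continuous_on UNIV h" "concave_on UNIV h"
    and r: "f w \<le> ereal (h w + r)" and bdd: "bounded {z. f z \<le> ereal (h z + r)}"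
  shows "\<exists>z c. f z = ereal (h z + c) \<and> (\<forall>w. ereal (h w + c) \<le> f w)"
proof -
  have h': "continuous_on UNIV (\<lambda>z. h z + a)" "concave_on UNIV (\<lambda>z. h z + a)" for a
    using h by (auto intro!: continuous_intros concave_on_add_const)
  \<comment> \<open>Upper levels of \<open>f - h\<close>; capping them by \<open>r\<close> keeps the
    points that witness them in the bounded set \<open>K\<close>.\<close>
  define A where "A = {a. a \<le> r \<and> (\<exists>z. f z \<le> ereal (h z + a))}"
  define K where "K = {z. f z \<le> ereal (h z + r)}"
  have K: "closed K" "convex K" "bounded K"
    unfolding K_def by (intro closed_sublevel convex_sublevel f h' bdd)+
  have "r \<in> A" using r by (auto simp: A_def)
  have "bdd_below A"
  proof (rule ccontr)
    assume "\<not> bdd_below A"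
    then have low: "\<exists>a\<in>A. a < b" for b by (meson bdd_below.unfold not_le)
    \<comment> \<open>A common point would have \<open>f z = -\<infinity>\<close>, which
      \<open>Gamma0\<close> excludes. The set for \<open>n = 0\<close> is the bounded level
      set.\<close>
    have "(\<Inter>n::nat. {z. f z \<le> ereal (h z + (r - real n))}) \<noteq> {}"
    proof (rule nested_closed_convex_inter_nonempty)
      fix n
      show "closed {z. f z \<le> ereal (h z + (r - real n))}" 
        by (intro closed_sublevel f h')
      show "convex {z. f z \<le> ereal (h z + (r - real n))}" 
        by (intro convex_sublevel f h')
      obtain a z where "a < r - real n" "f z \<le> ereal (h z + a)"
        using low unfolding A_def by blast
      then have "f z \<le> ereal (h z + (r - real n))" by (auto elim!: order_trans)
      then show "{z. f z \<le> ereal (h z + (r - real n))} \<noteq> {}" by auto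
      show "{z. f z \<le> ereal (h z + (r - real (Suc n)))} \<subseteq> {z. f z \<le> ereal (h z + (r - real n))}"
        by (auto elim!: order_trans)
    qed (use bdd in simp)
    then obtain z where z: "\<And>n. f z \<le> ereal (h z + (r - real n))" by auto
    obtain s where s: "f z = ereal s" using z[of 0] f by (cases "f z") (auto simp: Gamma0_def)
    obtain n where "h z + r - s < real n" using reals_Archimedean2 by blast
    then show False using z[of n] s by simp
  qed
  define c where "c = Inf A"
  have c_le: "c \<le> a" if "a \<in> A" for a using \<open>bdd_below A\<close> that by (simp add: c_def cInf_lower)
  have "\<exists>z\<in>K. f z \<le> ereal (h z + c)"
  proof (rule sublevel_attained[OF f h' K])
    fix e :: real assume "e > 0"
    then obtain a where a: "a \<in> A" "a < c + e"
      using cInf_lessD[of A "c + e"] \<open>r \<in> A\<close> by (auto simp: c_def)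
    then obtain z where z: "f z \<le> ereal (h z + a)" "a \<le> r" by (auto simp: A_def)
    then have "z \<in> K" by (auto simp: K_def elim!: order_trans)
    moreover have "f z \<le> ereal (h z + c + e)" using z a(2) by (auto elim!: order_trans)
    ultimately show "\<exists>z\<in>K. f z \<le> ereal (h z + c + e)" by blast
  qed
  then obtain z where z: "z \<in> K" "f z \<le> ereal (h z + c)" by blast
  have low: "ereal (h w + c) \<le> f w" for w
  proof (rule ccontr)
    assume *: "\<not> ereal (h w + c) \<le> f w"
    then obtain s where s: "f w = ereal s" "s < h w + c"
      using f by (cases "f w") (auto simp: Gamma0_def)
    have "s - h w < c" "c \<le> r" using s c_le[OF \<open>r \<in> A\<close>] by auto
    then have "s - h w \<in> A" unfolding A_def using s by (auto intro!: exI[of _ w])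
    then show False using c_le s by fastforce
  qed
  then have "f z = ereal (h z + c)" using z(2) by (intro antisym)
  then show ?thesis using low by blast
qed

section \<open>Monotone subgradients, proximal regularization and interior points of the domain of
  the conjugate\<close>

lemma subdiffE:
  assumes "f \<in> Gamma0" "u \<in> subdiff f x"
  obtains s where "f x = ereal s" "\<And>z. ereal (s + (z - x) \<bullet> u) \<le> f z"
  using assms subdiff_iff by blast

lemma subdiff_monotone:
  assumes "f \<in> Gamma0" "u \<in> subdiff f x" "v \<in> subdiff f z"
  shows "0 \<le> (z - x) \<bullet> (v - u)"
proof -
  obtain s where s: "f x = ereal s" "\<And>z. ereal (s + (z - x) \<bullet> u) \<le> f z"
    using subdiffE assms by metis
  obtain t where t: "f z = ereal t" "\<And>x. ereal (t + (x - z) \<bullet> v) \<le> f x"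
    using subdiffE assms by metis
  have "s + (z - x) \<bullet> u \<le> t" "t + (x - z) \<bullet> v \<le> s"
    using s(2)[of z] t(2)[of x] s(1) t(1) by auto
  then show ?thesis by (simp add: inner_diff)
qed

lemma real_le_if_le_small:
  fixes a b k :: real
  assumes "\<And>t. 0 < t \<Longrightarrow> t \<le> 1 \<Longrightarrow> a - t * k \<le> b"
  shows "a \<le> b"
proof (rule field_le_epsilon)
  fix e :: real assume e: "e > 0"
  define t where "t = min 1 (e / (\<bar>k\<bar> + 1))"
  have t: "0 < t" "t \<le> 1" "t \<le> e / (\<bar>k\<bar> + 1)" using e by (auto simp: t_def)
  have "t * k \<le> t * (\<bar>k\<bar> + 1)" using t by (intro mult_left_mono) auto
  also have "\<dots> \<le> e" using t(3) by (simp add: pos_le_divide_eq)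
  finally show "a \<le> b + e" using assms[OF t(1,2)] by linarith
qed

text \<open>Adds the proximal term \<open>e / 2 * (norm (z - x0))\<^sup>2\<close> to
  \<open>f\<close> minus the functional \<open>v\<close>. The affine minorant then makes level sets
  bounded, and the first-order condition at the minimizer is the claim.\<close>

lemma regularized_minimum:
  assumes f: "f \<in> Gamma0" and u: "\<And>z. ereal (z \<bullet> u - C) \<le> f z" and e: "e > 0"
  shows "\<exists>z. v - e *\<^sub>R (z - x0) \<in> subdiff f z"
proof -
  define h where "h z = z \<bullet> v - e / 2 * (norm (z - x0))\<^sup>2" for z
  have cont: "continuous_on UNIV h" unfolding h_def by (intro continuous_intros)
  have expand: "h (z + t *\<^sub>R w) = h z + t * (w \<bullet> (v - e *\<^sub>R (z - x0))) - e / 2 * t\<^sup>2 * (norm w)\<^sup>2"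
    for z w t
  proof -
    have "z + t *\<^sub>R w - x0 = (z - x0) + t *\<^sub>R w" by simp
    then have "(norm (z + t *\<^sub>R w - x0))\<^sup>2 = (norm (z - x0))\<^sup>2 + 2 * t * (w \<bullet> (z - x0)) + t\<^sup>2 * (norm w)\<^sup>2"
      by (simp only: power2_norm_eq_inner) (simp add: inner_simps inner_commute power2_eq_square algebra_simps)
    then show ?thesis unfolding h_def by (simp only:) (simp add: inner_simps field_simps)
  qed
  have conc: "concave_on UNIV h"
    unfolding concave_on_iff
  proof (intro conjI ballI allI impI convex_UNIV)
    fix x y :: 'a and a b :: real
    assume ab: "0 \<le> a" "0 \<le> b" "a + b = 1"
    define z where "z = a *\<^sub>R x + b *\<^sub>R y"
    have a: "a = 1 - b" using ab by simp
    \<comment> \<open>Seen from \<open>z\<close>, the points \<open>x\<close> and \<open>y\<close>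
      are the offsets \<open>- b\<close> and \<open>a\<close> along \<open>y - x\<close>, so the
      linear terms of \<open>expand\<close> cancel in the weighted sum.\<close>
    have xe: "z + (- b) *\<^sub>R (y - x) = x" and ye: "z + a *\<^sub>R (y - x) = y"
      unfolding z_def a by (auto simp: algebra_simps)
    define P where "P = (y - x) \<bullet> (v - e *\<^sub>R (z - x0))"
    define Q where "Q = e / 2 * (norm (y - x))\<^sup>2"
    have hx: "h x = h z + (- b) * P - b\<^sup>2 * Q" and hy: "h y = h z + a * P - a\<^sup>2 * Q"
      using expand[of z "- b" "y - x"] expand[of z a "y - x"] unfolding xe ye P_def Q_def by simp_all
    have "a * h x + b * h y = (a + b) * h z - a * b * (a + b) * Q"
      unfolding hx hy by (simp add: algebra_simps power2_eq_square)
    moreover have "0 \<le> a * b * (a + b) * Q"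
      using ab e by (simp add: Q_def)
    ultimately show "a * h x + b * h y \<le> h (a *\<^sub>R x + b *\<^sub>R y)"
      using ab by (simp add: z_def)
  qed
  obtain w where "w \<in> edom f" using f by (auto simp: Gamma0_def)
  then obtain s where w: "f w = ereal s" using Gamma0_finite[OF f] by blast
  define A where "A = C + (s - h w) + x0 \<bullet> (v - u)"
  have "bounded {z. f z \<le> ereal (h z + (s - h w))}"
  proof (rule bounded_subset[OF bounded_cball], safe)
    fix z assume "f z \<le> ereal (h z + (s - h w))"
    then have "ereal (z \<bullet> u - C) \<le> ereal (h z + (s - h w))" using u[of z] by (rule order_trans[rotated])
    then have le: "e / 2 * (norm (z - x0))\<^sup>2 \<le> (z - x0) \<bullet> (v - u) + A"
      by (simp add: h_def A_def inner_simps)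
    define d where "d = norm (z - x0)"
    have "(z - x0) \<bullet> (v - u) \<le> d * norm (v - u)" unfolding d_def by (rule norm_cauchy_schwarz)
    then have le2: "e / 2 * d\<^sup>2 \<le> d * norm (v - u) + \<bar>A\<bar>" using le by (simp add: d_def)
    \<comment> \<open>For \<open>d > 1\<close> the constant is at most
      \<open>\<bar>A\<bar> * d\<close>; dividing the quadratic inequality by \<open>d\<close> gives
      the second bound.\<close>
    have "d \<le> max 1 ((norm (v - u) + \<bar>A\<bar>) * 2 / e)"
    proof (rule ccontr)
      assume n: "\<not> ?thesis"
      then have d: "d > 1" "(norm (v - u) + \<bar>A\<bar>) * 2 / e < d" by auto
      then have "norm (v - u) + \<bar>A\<bar> < e / 2 * d" using e by (simp add: field_simps)
      then have "(norm (v - u) + \<bar>A\<bar>) * d < e / 2 * d * d" 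
        using d by (intro mult_strict_right_mono) auto
      moreover have "\<bar>A\<bar> * 1 \<le> \<bar>A\<bar> * d" using d by (intro mult_left_mono) auto
      ultimately show False using le2 by (simp add: algebra_simps power2_eq_square)
    qed
    then show "z \<in> cball x0 (max 1 ((norm (v - u) + \<bar>A\<bar>) * 2 / e))"
      by (simp add: d_def dist_norm norm_minus_commute)
  qed
  then obtain z c where z: "f z = ereal (h z + c)" "\<And>w. ereal (h w + c) \<le> f w"
    using minimum_attained[OF f cont conc, of w "s - h w"] w by auto
  have "f z + ereal ((w - z) \<bullet> (v - e *\<^sub>R (z - x0))) \<le> f w" for w
  proof (cases "w \<in> edom f")
    case True
    then obtain b where b: "f w = ereal b" using Gamma0_finite f by metis
    \<comment> \<open>Comparing \<open>z\<close> with the point at parameter \<open>t\<close> on the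
      segment to \<open>w\<close> and dividing by \<open>t\<close> leaves an error proportional to
      \<open>t\<close>.\<close>
    have "(w - z) \<bullet> (v - e *\<^sub>R (z - x0)) \<le> b - (h z + c)"
    proof (rule real_le_if_le_small)
      fix t :: real assume t: "0 < t" "t \<le> 1"
      have "f ((1 - t) *\<^sub>R z + t *\<^sub>R w) \<le> ereal ((1 - t) * (h z + c) + t * b)"
        using t z b by (intro Gamma0_convex_bound f) auto
      with z(2) have "ereal (h ((1 - t) *\<^sub>R z + t *\<^sub>R w) + c) \<le> ereal ((1 - t) * (h z + c) + t * b)"
        by (rule order_trans)
      moreover have "(1 - t) *\<^sub>R z + t *\<^sub>R w = z + t *\<^sub>R (w - z)" by (simp add: algebra_simps)
      ultimately have "h (z + t *\<^sub>R (w - z)) + c \<le> (1 - t) * (h z + c) + t * b" by simp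
      then have "t * ((w - z) \<bullet> (v - e *\<^sub>R (z - x0)) - t * (e / 2 * (norm (w - z))\<^sup>2)) \<le> t * (b - (h z + c))"
        unfolding expand by (simp add: algebra_simps power2_eq_square)
      then show "(w - z) \<bullet> (v - e *\<^sub>R (z - x0)) - t * (e / 2 * (norm (w - z))\<^sup>2) \<le> b - (h z + c)"
        using t by simp
    qed
    then show ?thesis using z(1) b by simp
  qed (simp add: edom_def)
  then show ?thesis unfolding subdiff_def by blast
qed

text \<open>
  For \<open>v\<close> close to \<open>u\<close>, the minimizers of \<open>f - (\<bullet>) v\<close> regularized by \<open>(t/2) \<parallel>\<cdot> - x0\<parallel>\<^sup>2\<close> are, by monotonicity
  of the subdifferential, in the bounded union. Letting \<open>t \<rightarrow> 0\<close> bounds \<open>f\<^sup>* v\<close>.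
\<close>

lemma interior_edom_conj_if_locally_bounded:
  assumes f: "f \<in> Gamma0" and x0: "x0 \<in> inv_subdiff f u"
    and e: "e > 0" and bdd: "bounded (\<Union>v\<in>ball u e. inv_subdiff f v)"
  shows "u \<in> interior (edom (fenchel_conj f))"
proof -
  obtain R where R: "\<And>v x. v \<in> ball u e \<Longrightarrow> x \<in> inv_subdiff f v \<Longrightarrow> norm x \<le> R"
    using bdd unfolding bounded_iff by blast
  obtain s where s: "f x0 = ereal s" "\<And>z. ereal (s + (z - x0) \<bullet> u) \<le> f z"
    using subdiffE f x0 by (metis inv_subdiff_def mem_Collect_eq)
  have minorant: "ereal (z \<bullet> u - (x0 \<bullet> u - s)) \<le> f z" for z
    using s(2)[of z] by (simp add: inner_simps algebra_simps)
  \<comment> \<open>Why half the radius: monotonicity bounds the shift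
    \<open>t *\<^sub>R (z - x0)\<close> by \<open>norm (v - u)\<close>, so the shifted slope stays
    within \<open>2 * norm (v - u) < e\<close> of \<open>u\<close>.\<close>
  have "ball u (e / 2) \<subseteq> edom (fenchel_conj f)"
  proof
    fix v assume "v \<in> ball u (e / 2)"
    then have v: "norm (v - u) < e / 2" by (simp add: dist_norm norm_minus_commute)
    \<comment> \<open>\<open>C\<close> bounds \<open>z \<bullet> v - f z\<close> whenever
      \<open>norm z \<le> R\<close>: Cauchy-Schwarz for the first term, the subgradient
      \<open>u\<close> at \<open>x0\<close> for the second.\<close>
    define C where "C = R * norm v - s + (R + norm x0) * norm u"
    have "ereal (w \<bullet> v - C) \<le> f w" for w
    proof (cases "w \<in> edom f")
      case True
      then obtain b where b: "f w = ereal b" using Gamma0_finite f by metis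
      have "w \<bullet> v - C \<le> b"
      proof (rule real_le_if_le_small)
        fix t :: real assume t: "0 < t" "t \<le> 1"
        obtain z where z: "v - t *\<^sub>R (z - x0) \<in> subdiff f z"
          using regularized_minimum[OF f minorant t(1)] by blast
        have "0 \<le> (z - x0) \<bullet> (v - t *\<^sub>R (z - x0) - u)"
          using subdiff_monotone[OF f _ z] x0 by (simp add: inv_subdiff_def)
        then have "t * (norm (z - x0))\<^sup>2 \<le> (z - x0) \<bullet> (v - u)"
          by (simp add: power2_norm_eq_inner inner_simps)
        also have "\<dots> \<le> norm (z - x0) * norm (v - u)" by (rule norm_cauchy_schwarz)
        finally have "t * norm (z - x0) \<le> norm (v - u)"
          by (cases "z = x0") (auto simp: power2_eq_square)
        then have "norm (t *\<^sub>R (z - x0)) \<le> norm (v - u)" using t by simp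
        moreover have "norm (v - t *\<^sub>R (z - x0) - u) \<le> norm (v - u) + norm (t *\<^sub>R (z - x0))"
          using norm_triangle_ineq4[of "v - u" "t *\<^sub>R (z - x0)"] by (simp add: diff_diff_eq add.commute)
        ultimately have "norm (u - (v - t *\<^sub>R (z - x0))) < e"
          using v by (subst norm_minus_commute) linarith
        then have zR: "norm z \<le> R" using R z by (simp add: inv_subdiff_def dist_norm)
        obtain a where a: "f z = ereal a" "\<And>w. ereal (a + (w - z) \<bullet> (v - t *\<^sub>R (z - x0))) \<le> f w"
          using subdiffE[OF f z] by blast
        have "a + (w - z) \<bullet> (v - t *\<^sub>R (z - x0)) \<le> b" using a(2)[of w] b by simp
        then have 1: "a + w \<bullet> v - z \<bullet> v - t * ((w - z) \<bullet> (z - x0)) \<le> b"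
          by (simp add: inner_simps algebra_simps)
        have 2: "s + (z - x0) \<bullet> u \<le> a" using s(2)[of z] a(1) by simp
        have zx: "norm (z - x0) \<le> R + norm x0" using zR norm_triangle_ineq4[of z x0] by simp
        have R0: "0 \<le> R" using zR norm_ge_zero[of z] by linarith
        have "- ((z - x0) \<bullet> u) \<le> norm (z - x0) * norm u"
          using Cauchy_Schwarz_ineq2[of "z - x0" u] by linarith
        also have "\<dots> \<le> (R + norm x0) * norm u" using zx by (intro mult_right_mono) auto
        finally have 3: "- ((z - x0) \<bullet> u) \<le> (R + norm x0) * norm u" .
        have "z \<bullet> v \<le> norm z * norm v" by (rule norm_cauchy_schwarz)
        also have "\<dots> \<le> R * norm v" using zR by (intro mult_right_mono) auto
        finally have 4: "z \<bullet> v \<le> R * norm v" .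
        have "(w - z) \<bullet> (z - x0) \<le> norm (w - z) * norm (z - x0)" by (rule norm_cauchy_schwarz)
        also have "\<dots> \<le> (norm w + R) * (R + norm x0)"
          using zR zx norm_triangle_ineq4[of w z] R0 by (intro mult_mono) auto
        finally have "t * ((w - z) \<bullet> (z - x0)) \<le> t * ((norm w + R) * (R + norm x0))"
          using t by (intro mult_left_mono) auto
        then show "w \<bullet> v - C - t * ((norm w + R) * (R + norm x0)) \<le> b"
          using 1 2 3 4 unfolding C_def by linarith
      qed
      then show ?thesis using b by simp
    qed (simp add: edom_def)
    then show "v \<in> edom (fenchel_conj f)" using edom_fenchel_conj_iff[OF f] by blast
  qed
  then show ?thesis using e by (auto simp: mem_interior intro!: exI[of _ "e / 2"])
qed

section \<open>Coercivity and minimizers for slopes interior to the domain of the conjugate\<close>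

lemma baire_closed_cover:
  fixes T :: "nat \<Rightarrow> 'a::complete_space set"
  assumes closed: "\<And>n. closed (T n)" and cover: "U \<subseteq> (\<Union>n. T n)" and U: "interior U \<noteq> {}"
  shows "\<exists>n. interior (T n) \<noteq> {}"
proof (rule ccontr)
  assume "\<not> ?thesis"
  then have "Met_TC.mtopology interior_of \<Union>(range T) = {}"
    using closed complete_UNIV[where 'a = 'a]
    by (intro Met_TC.metric_Baire_category_alt)
       auto
  then have "interior (\<Union>(range T)) = {}" by simp
  then show False using U interior_mono[OF cover] by auto
qed

text \<open>
  Lower semicontinuity and Baire's theorem bound \<open>f\<^sup>*\<close> above on some ball, and convexity moves this
  bound to a neighbourhood of \<open>u\<close>; dually, \<open>f - (\<bullet>) u\<close> grows linearly.
\<close>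

lemma coercive_if_interior_edom_conj:
  assumes f: "f \<in> Gamma0" and u: "u \<in> interior (edom (fenchel_conj f))"
  obtains r C where "r > 0" "\<And>z. ereal (z \<bullet> u + r * norm z - C) \<le> f z"
proof -
  define T where "T n = {v. \<forall>z. ereal (z \<bullet> v - real n) \<le> f z}" for n
  have closed: "closed (T n)" for n
  proof -
    have "T n = (\<Inter>z. {v. ereal (z \<bullet> v - real n) \<le> f z})" by (auto simp: T_def)
    moreover have "closed {v. ereal (z \<bullet> v - real n) \<le> f z}" for z
      using f by (cases "f z") (auto simp: Gamma0_def intro!: closed_Collect_le continuous_intros)
    ultimately show ?thesis by auto
  qed
  have cover: "edom (fenchel_conj f) \<subseteq> (\<Union>n. T n)"
  proof
    fix v assume "v \<in> edom (fenchel_conj f)"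
    then obtain C where C: "\<And>z. ereal (z \<bullet> v - C) \<le> f z" using edom_fenchel_conj_iff[OF f] by blast
    obtain n where "C < real n" using reals_Archimedean2 by blast
    then have "ereal (z \<bullet> v - real n) \<le> f z" for z by (intro order_trans[OF _ C]) simp
    then show "v \<in> (\<Union>n. T n)" by (auto simp: T_def)
  qed
  have "interior (edom (fenchel_conj f)) \<noteq> {}" using u by blast
  then obtain n where "interior (T n) \<noteq> {}"
    using baire_closed_cover[OF closed cover] by blast
  then obtain w where "w \<in> interior (T n)" by blast
  then obtain d where d: "d > 0" "cball w d \<subseteq> T n"
    unfolding mem_interior_cball by blast
  obtain r where r: "r > 0" "cball u r \<subseteq> edom (fenchel_conj f)"
    using u unfolding mem_interior_cball by blast
  \<comment> \<open>\<open>s\<close> is small enough for \<open>u + s *\<^sub>R (u - w)\<close> to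
    stay in the ball about \<open>u\<close>; then \<open>u\<close> is the convex combination of it
    and \<open>w\<close> with weights \<open>1 / (1 + s)\<close> and
    \<open>s / (1 + s)\<close>.\<close>
  define s where "s = r / (norm (u - w) + 1)"
  have pos: "norm (u - w) + 1 > 0" by (simp add: add_nonneg_pos)
  have s: "s > 0" using r pos by (simp add: s_def)
  have "s * norm (u - w) \<le> s * (norm (u - w) + 1)" using s by (intro mult_left_mono) auto
  also have "\<dots> = r" using pos by (simp add: s_def)
  finally have sr: "s * norm (u - w) \<le> r" .
  have "u + s *\<^sub>R (u - w) \<in> edom (fenchel_conj f)"
    using s sr by (intro subsetD[OF r(2)]) (simp add: dist_norm)
  then obtain C where C: "\<And>z. ereal (z \<bullet> (u + s *\<^sub>R (u - w)) - C) \<le> f z"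
    using edom_fenchel_conj_iff[OF f] by blast
  show thesis
  proof
    show "s * d / (1 + s) > 0" using s d by simp
    fix z
    show "ereal (z \<bullet> u + s * d / (1 + s) * norm z - (C + s * n) / (1 + s)) \<le> f z"
    proof (cases "z \<in> edom f")
      case True
      then obtain b where b: "f z = ereal b" using Gamma0_finite f by metis
      \<comment> \<open>Among the slopes within \<open>d\<close> of \<open>w\<close>, this one gains
        most at \<open>z\<close>, namely \<open>d * norm z\<close>.\<close>
      have "w + d *\<^sub>R sgn z \<in> T n"
        using d by (intro subsetD[OF d(2)]) (auto simp: dist_norm norm_sgn)
      then have "ereal (z \<bullet> (w + d *\<^sub>R sgn z) - n) \<le> f z" unfolding T_def by blast
      then have "z \<bullet> (w + d *\<^sub>R sgn z) - n \<le> b" using b by simp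
      moreover have "z \<bullet> sgn z = norm z"
        by (cases "z = 0") (simp_all add: sgn_div_norm dot_square_norm power2_eq_square)
      ultimately have "z \<bullet> w + d * norm z - n \<le> b" by (simp add: inner_simps)
      then have "s * (z \<bullet> w + d * norm z - n) \<le> s * b" using s by (intro mult_left_mono) auto
      moreover have "z \<bullet> (u + s *\<^sub>R (u - w)) - C \<le> b" using C[of z] b by simp
      ultimately have "(1 + s) * (z \<bullet> u) + s * d * norm z - (C + s * n) \<le> (1 + s) * b"
        by (simp add: inner_simps algebra_simps)
      then have "((1 + s) * (z \<bullet> u) + s * d * norm z - (C + s * n)) / (1 + s) \<le> b"
        using s by (simp add: pos_divide_le_eq mult.commute)
      then show ?thesis using b s by (simp add: add_divide_distrib diff_divide_distrib)
    qed (simp add: edom_def)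
  qed
qed

lemma inv_subdiff_nonempty:
  assumes f: "f \<in> Gamma0" and u: "u \<in> interior (edom (fenchel_conj f))"
  shows "inv_subdiff f u \<noteq> {}"
proof -
  obtain r C where r: "r > 0" and C: "\<And>z. ereal (z \<bullet> u + r * norm z - C) \<le> f z"
    using coercive_if_interior_edom_conj[OF assms] by blast
  obtain w where "w \<in> edom f" using f by (auto simp: Gamma0_def)
  then obtain s where w: "f w = ereal s" using Gamma0_finite[OF f] by blast
  have "bounded {z. f z \<le> ereal (z \<bullet> u + (s - w \<bullet> u))}"
  proof (rule boundedI, safe)
    fix z assume "f z \<le> ereal (z \<bullet> u + (s - w \<bullet> u))"
    then have "ereal (z \<bullet> u + r * norm z - C) \<le> ereal (z \<bullet> u + (s - w \<bullet> u))"
      using C[of z] by (rule order_trans[rotated])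
    then have "r * norm z \<le> C + (s - w \<bullet> u)" by simp
    then show "norm z \<le> (C + (s - w \<bullet> u)) / r" using r by (simp add: field_simps)
  qed
  moreover have "concave_on UNIV (\<lambda>z. z \<bullet> u)"
    by (simp add: concave_on_iff inner_simps)
  moreover have "continuous_on UNIV (\<lambda>z. z \<bullet> u)" by (intro continuous_intros)
  ultimately obtain z c where z: "f z = ereal (z \<bullet> u + c)" "\<And>w. ereal (w \<bullet> u + c) \<le> f w"
    using minimum_attained[OF f, of "\<lambda>z. z \<bullet> u" w "s - w \<bullet> u"] w by auto
  then have "u \<in> subdiff f z"
    unfolding subdiff_iff[OF f] by (auto simp: inner_simps add.commute)
  then show ?thesis by (auto simp: inv_subdiff_def)
qed

section \<open>Weak continuity of minimizers and differentiability of the conjugate\<close>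

text \<open>
  If this failed, points \<open>z\<close> with \<open>z \<bullet> h \<ge> x \<bullet> h + n\<close> would be a bounded minimizing sequence of
  \<open>f - (\<bullet>) u\<close>, which would then have a second minimizer in that half-space.
\<close>

lemma inv_subdiff_weakly_upper_semicontinuous:
  assumes f: "f \<in> Gamma0" and x: "inv_subdiff f u = {x}"
    and e: "e > 0" and bdd: "bounded (\<Union>v\<in>ball u e. inv_subdiff f v)" and n: "n > 0"
  shows "\<exists>d>0. \<forall>v\<in>ball u d. \<forall>z\<in>inv_subdiff f v. z \<bullet> h < x \<bullet> h + n"
proof (rule ccontr)
  assume contra: "\<not> ?thesis"
  obtain R where R: "\<And>v x. v \<in> ball u e \<Longrightarrow> x \<in> inv_subdiff f v \<Longrightarrow> norm x \<le> R"
    using bdd unfolding bounded_iff by blast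
  have xu: "u \<in> subdiff f x" using x by (auto simp: inv_subdiff_def)
  then obtain s where s: "f x = ereal s" "\<And>z. ereal (s + (z - x) \<bullet> u) \<le> f z"
    using subdiffE[OF f] by blast
  have "norm x \<le> R" using R[of u x] x e by simp
  then have R0: "0 \<le> R" using norm_ge_zero order_trans by blast
  define K where "K = cball 0 R \<inter> {z. h \<bullet> z \<ge> x \<bullet> h + n}"
  have "\<exists>z\<in>K. f z \<le> ereal (z \<bullet> u + (s - x \<bullet> u))"
  proof (rule sublevel_attained[OF f])
    show "continuous_on UNIV (\<lambda>z. z \<bullet> u + (s - x \<bullet> u))" by (intro continuous_intros)
    show "concave_on UNIV (\<lambda>z. z \<bullet> u + (s - x \<bullet> u))"
      by (intro concave_on_add_const) (simp add: concave_on_iff inner_simps)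
    show "closed K" "bounded K" "convex K"
      unfolding K_def by (auto intro!: closed_Int closed_halfspace_ge bounded_Int convex_Int convex_halfspace_ge)
    fix a :: real assume a: "a > 0"
    \<comment> \<open>For \<open>v\<close> within \<open>d\<close> of \<open>u\<close>, exchanging
      the slope \<open>v\<close> for \<open>u\<close> costs at most
      \<open>(R + norm x) * d \<le> a\<close>; the \<open>+ 1\<close> keeps the denominator
      positive.\<close>
    define d where "d = min e (a / (R + norm x + 1))"
    have d: "d > 0" "d \<le> e" "(R + norm x) * d \<le> a"
    proof -
      have pos: "R + norm x + 1 > 0" using R0 by (simp add: add_nonneg_pos)
      then show "d > 0" "d \<le> e" using e a by (auto simp: d_def)
      have "(R + norm x) * d \<le> (R + norm x + 1) * d" using \<open>d > 0\<close> by (intro mult_right_mono) auto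
      also have "\<dots> \<le> (R + norm x + 1) * (a / (R + norm x + 1))"
        using pos by (intro mult_left_mono) (auto simp: d_def)
      also have "\<dots> = a" using pos by simp
      finally show "(R + norm x) * d \<le> a" .
    qed
    have "\<not> (\<forall>v\<in>ball u d. \<forall>z\<in>inv_subdiff f v. z \<bullet> h < x \<bullet> h + n)" using contra d(1) by blast
    then obtain v z where v: "v \<in> ball u d" and z: "z \<in> inv_subdiff f v" "z \<bullet> h \<ge> x \<bullet> h + n"
      by (auto simp: not_less)
    have zR: "norm z \<le> R" using R[of v z] v z d by auto
    have "v \<in> subdiff f z" using z by (simp add: inv_subdiff_def)
    then obtain b where b: "f z = ereal b" "\<And>w. ereal (b + (w - z) \<bullet> v) \<le> f w"
      using subdiffE[OF f] by blast
    have "b + (x - z) \<bullet> v \<le> s" using b(2)[of x] s(1) by simp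
    moreover have "(z - x) \<bullet> (v - u) \<le> a"
    proof -
      have "(z - x) \<bullet> (v - u) \<le> norm (z - x) * norm (v - u)" by (rule norm_cauchy_schwarz)
      also have "\<dots> \<le> (R + norm x) * d"
        using v zR R0 norm_triangle_ineq4[of z x] by (intro mult_mono) (auto simp: dist_norm norm_minus_commute)
      finally show ?thesis using d by simp
    qed
    ultimately have "b \<le> z \<bullet> u + (s - x \<bullet> u) + a" by (simp add: inner_simps)
    moreover have "z \<in> K" using zR z by (auto simp: K_def inner_commute)
    ultimately show "\<exists>z\<in>K. f z \<le> ereal (z \<bullet> u + (s - x \<bullet> u) + a)"
      using b(1) by (intro bexI[of _ z]) simp_all
  qed
  then obtain z where z: "z \<in> K" "f z \<le> ereal (z \<bullet> u + (s - x \<bullet> u))" by blast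
  have "z \<bullet> u + (s - x \<bullet> u) = s + (z - x) \<bullet> u" by (simp add: inner_simps)
  with z(2) s(2)[of z] have "f z = ereal (s + (z - x) \<bullet> u)" by (intro antisym) auto
  moreover have "ereal (s + (z - x) \<bullet> u + (w - z) \<bullet> u) \<le> f w" for w
    using s(2)[of w] by (simp add: inner_diff_left)
  ultimately have "u \<in> subdiff f z"
    unfolding subdiff_iff[OF f] by blast
  then have "z = x" using x by (auto simp: inv_subdiff_def)
  then show False using z n by (auto simp: K_def inner_commute)
qed

text \<open>The difference quotient along \<open>h\<close> lies between \<open>x \<bullet> h\<close>
  and \<open>z \<bullet> h\<close>, where \<open>z\<close> is a minimizer for the slope
  \<open>u + t *\<^sub>R h\<close>; weak continuity squeezes it.\<close>

lemma fenchel_conj_has_gateaux_gradient: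
  assumes f: "f \<in> Gamma0" and u: "u \<in> interior (edom (fenchel_conj f))"
    and x: "inv_subdiff f u = {x}"
    and e: "e > 0" and bdd: "bounded (\<Union>v\<in>ball u e. inv_subdiff f v)"
  shows "has_gateaux_gradient (fenchel_conj f) u x"
  unfolding has_gateaux_gradient_def
proof (intro conjI allI u)
  fix h
  define q where "q t = real_of_ereal (fenchel_conj f (u + t *\<^sub>R h))" for t
  \<comment> \<open>The Fenchel-Young inequality in real numbers; the subgradient \<open>u'\<close>
    makes \<open>f z\<close> finite, so \<open>real_of_ereal\<close> is faithful there.\<close>
  have q_ge: "z \<bullet> (u + t *\<^sub>R h) - real_of_ereal (f z) \<le> q t"
    if in_int: "u + t *\<^sub>R h \<in> interior (edom (fenchel_conj f))" and z: "u' \<in> subdiff f z" for t z u'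
  proof -
    obtain x' where x': "x' \<in> inv_subdiff f (u + t *\<^sub>R h)"
      using inv_subdiff_nonempty[OF f] in_int by blast
    then have "u + t *\<^sub>R h \<in> subdiff f x'" by (simp add: inv_subdiff_def)
    then obtain s where s: "f x' = ereal s" "\<And>z. ereal (s + (z - x') \<bullet> (u + t *\<^sub>R h)) \<le> f z"
      using subdiffE[OF f] by blast
    obtain b where "f z = ereal b" using subdiffE[OF f z] by blast
    then show ?thesis
      using s(2)[of z] s(1) unfolding q_def fenchel_conj_eq[OF f x'] by (simp add: inner_diff_left)
  qed
  show "(q has_real_derivative x \<bullet> h) (at 0)"
    unfolding DERIV_def
  proof (rule LIM_I)
    fix n :: real assume n: "n > 0"
    obtain d1 where d1: "d1 > 0" "\<And>v z. v \<in> ball u d1 \<Longrightarrow> z \<in> inv_subdiff f v \<Longrightarrow> z \<bullet> h < x \<bullet> h + n"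
      using inv_subdiff_weakly_upper_semicontinuous[OF f x e bdd n, of h] by blast
    \<comment> \<open>Semicontinuity bounds from above only; the direction \<open>-h\<close>
      supplies the lower bound on \<open>z \<bullet> h\<close>.\<close>
    obtain d2 where d2: "d2 > 0" "\<And>v z. v \<in> ball u d2 \<Longrightarrow> z \<in> inv_subdiff f v \<Longrightarrow> z \<bullet> (-h) < x \<bullet> (-h) + n"
      using inv_subdiff_weakly_upper_semicontinuous[OF f x e bdd n, of "-h"] by blast
    obtain d3 where d3: "d3 > 0" "ball u d3 \<subseteq> interior (edom (fenchel_conj f))"
      using u open_interior open_contains_ball by blast
    define d where "d = min d1 (min d2 d3) / (norm h + 1)"
    have h1: "norm h + 1 > 0" by (simp add: add_nonneg_pos)
    have "d > 0" using d1(1) d2(1) d3(1) h1 by (simp add: d_def)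
    have "norm ((q (0 + t) - q 0) / t - x \<bullet> h) < n" if t: "t \<noteq> 0 \<and> norm (t - 0) < d" for t
    proof -
      have "\<bar>t\<bar> * norm h \<le> \<bar>t\<bar> * (norm h + 1)" by (intro mult_left_mono) auto
      also have "\<dots> < min d1 (min d2 d3)" using t h1 by (simp add: d_def pos_less_divide_eq)
      finally have v: "u + t *\<^sub>R h \<in> ball u d1" "u + t *\<^sub>R h \<in> ball u d2" "u + t *\<^sub>R h \<in> ball u d3"
        by (auto simp: dist_norm)
      then have int: "u + t *\<^sub>R h \<in> interior (edom (fenchel_conj f))" using d3 by blast
      then obtain z where z: "z \<in> inv_subdiff f (u + t *\<^sub>R h)" using inv_subdiff_nonempty[OF f] by blast
      have zs: "u + t *\<^sub>R h \<in> subdiff f z" using z by (simp add: inv_subdiff_def)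
      have xx: "x \<in> inv_subdiff f u" using x by simp
      then have xs: "u \<in> subdiff f x" by (simp add: inv_subdiff_def)
      have zh: "z \<bullet> h < x \<bullet> h + n" "z \<bullet> h > x \<bullet> h - n"
        using d1(2)[OF v(1) z] d2(2)[OF v(2) z] by auto
      have qt: "q t = z \<bullet> (u + t *\<^sub>R h) - real_of_ereal (f z)" 
        unfolding q_def fenchel_conj_eq[OF f z] by simp
      have q0: "q 0 = x \<bullet> u - real_of_ereal (f x)" 
        unfolding q_def using fenchel_conj_eq[OF f xx] by simp
      \<comment> \<open>\<open>lo\<close> tests the old minimizer \<open>x\<close> at the new slope,
        \<open>hi\<close> the new minimizer \<open>z\<close> at the old slope.\<close>
      have lo: "t * (x \<bullet> h) \<le> q t - q 0"
        using q_ge[OF int xs] q0 by (simp add: inner_simps)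
      have hi: "q t - q 0 \<le> t * (z \<bullet> h)"
        using q_ge[of 0, OF _ zs] u qt by (simp add: inner_simps)
      show ?thesis
      proof (cases "t > 0")
        case True
        then have "x \<bullet> h \<le> (q t - q 0) / t" "(q t - q 0) / t \<le> z \<bullet> h"
          using lo hi by (simp_all add: pos_le_divide_eq pos_divide_le_eq mult.commute)
        then show ?thesis using zh n by simp
      next
        case False
        then have "t < 0" using t by simp
        then have "(q t - q 0) / t \<le> x \<bullet> h" "z \<bullet> h \<le> (q t - q 0) / t"
          using lo hi by (simp_all add: neg_le_divide_eq neg_divide_le_eq mult.commute)
        then show ?thesis using zh n by simp
      qed
    qed
    then show "\<exists>d>0. \<forall>t. t \<noteq> 0 \<and> norm (t - 0) < d \<longrightarrow> norm ((q (0 + t) - q 0) / t - x \<bullet> h) < n"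
      using \<open>d > 0\<close> by blast
  qed
qed

section \<open>The Gateaux gradient as the only subgradient\<close>

lemma has_gateaux_gradient_unique:
  assumes "has_gateaux_gradient f x g" "has_gateaux_gradient f x g'"
  shows "g = g'"
proof -
  have "g \<bullet> h = g' \<bullet> h" for h
    using assms DERIV_unique unfolding has_gateaux_gradient_def by blast
  then have "(g - g') \<bullet> (g - g') = 0" by (simp add: inner_diff_left)
  then show ?thesis by simp
qed

lemma grad_eqI: "has_gateaux_gradient f x g \<Longrightarrow> grad f x = g"
  unfolding grad_def using has_gateaux_gradient_unique by (blast intro: the_equality)

text \<open>By convexity the difference quotients towards \<open>z\<close> are at most
  \<open>f z - f x\<close> for \<open>0 < t < 1\<close>, hence so is their limit from the
  right.\<close>

lemma gateaux_gradient_in_subdiff: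
  assumes f: "f \<in> Gamma0" and g: "has_gateaux_gradient f x g"
  shows "g \<in> subdiff f x"
proof -
  have "x \<in> edom f" using g interior_subset by (auto simp: has_gateaux_gradient_def)
  then obtain s where s: "f x = ereal s" using Gamma0_finite f by metis
  have "ereal (s + (z - x) \<bullet> g) \<le> f z" for z
  proof (cases "z \<in> edom f")
    case True
    then obtain b where b: "f z = ereal b" using Gamma0_finite f by metis
    define q where "q t = real_of_ereal (f (x + t *\<^sub>R (z - x)))" for t
    have "(q has_real_derivative g \<bullet> (z - x)) (at 0)"
      using g unfolding has_gateaux_gradient_def q_def by blast
    then have "((\<lambda>t. (q t - s) / t) \<longlongrightarrow> g \<bullet> (z - x)) (at 0)"
      by (simp add: DERIV_def q_def s)
    then have lim: "((\<lambda>t. (q t - s) / t) \<longlongrightarrow> g \<bullet> (z - x)) (at_right 0)"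
      by (rule Lim_at_imp_Lim_at_within)
    have "g \<bullet> (z - x) \<le> b - s"
    proof (rule tendsto_upperbound[OF lim])
      show "eventually (\<lambda>t. (q t - s) / t \<le> b - s) (at_right 0)"
      proof (rule eventually_at_rightI[of 0 1])
        fix t :: real assume t: "t \<in> {0<..<1}"
        have "f ((1 - t) *\<^sub>R x + t *\<^sub>R z) \<le> ereal ((1 - t) * s + t * b)"
          using t by (intro Gamma0_convex_bound f) (auto simp: s b)
        moreover have "(1 - t) *\<^sub>R x + t *\<^sub>R z = x + t *\<^sub>R (z - x)" by (simp add: algebra_simps)
        moreover have "f (x + t *\<^sub>R (z - x)) \<noteq> -\<infinity>" using f by (auto simp: Gamma0_def)
        ultimately have "q t \<le> (1 - t) * s + t * b"
          unfolding q_def by (cases "f (x + t *\<^sub>R (z - x))") auto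
        then have "q t - s \<le> (b - s) * t" by (simp add: algebra_simps)
        then show "(q t - s) / t \<le> b - s" using t by (simp add: pos_divide_le_eq)
      qed simp
    qed simp
    then show ?thesis using b by (simp add: inner_commute)
  qed (simp add: edom_def)
  then show ?thesis using s by (auto simp: subdiff_iff[OF f])
qed

text \<open>Along \<open>h = g - v\<close>, subtracting the minorant of slope \<open>v\<close> from
  \<open>f\<close> leaves a local minimum at \<open>0\<close>, so the derivative
  \<open>h \<bullet> h\<close> vanishes.\<close>

lemma subdiff_eq_gateaux_gradient:
  assumes f: "f \<in> Gamma0" and g: "has_gateaux_gradient f x g" and v: "v \<in> subdiff f x"
  shows "v = g"
proof -
  define h where "h = g - v"
  obtain s where s: "f x = ereal s" "\<And>z. ereal (s + (z - x) \<bullet> v) \<le> f z"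
    using subdiffE[OF f v] by blast
  obtain d where d: "d > 0" "ball x d \<subseteq> edom f"
    using g unfolding has_gateaux_gradient_def mem_interior by blast
  define q where "q t = real_of_ereal (f (x + t *\<^sub>R h)) - t * (v \<bullet> h)" for t
  have "(q has_real_derivative (g \<bullet> h - 1 * (v \<bullet> h))) (at 0)"
    unfolding q_def using g
    by (intro DERIV_diff DERIV_cmult_right DERIV_ident) (auto simp: has_gateaux_gradient_def)
  moreover have pos: "norm h + 1 > 0" by (simp add: add_nonneg_pos)
  have "q 0 \<le> q t" if "\<bar>0 - t\<bar> < d / (norm h + 1)" for t
  proof -
    have "\<bar>t\<bar> * norm h \<le> \<bar>t\<bar> * (norm h + 1)" by (intro mult_left_mono) auto
    also have "\<dots> < d" using that pos by (simp add: pos_less_divide_eq)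
    finally have "x + t *\<^sub>R h \<in> edom f" using d by (intro subsetD[OF d(2)]) (simp add: dist_norm)
    then obtain b where "f (x + t *\<^sub>R h) = ereal b" using Gamma0_finite f by metis
    then show ?thesis using s(2)[of "x + t *\<^sub>R h"] s(1) by (simp add: q_def inner_commute)
  qed
  moreover have "d / (norm h + 1) > 0" using d pos by simp
  ultimately have "g \<bullet> h - 1 * (v \<bullet> h) = 0" using DERIV_local_min by blast
  then have "h \<bullet> h = 0" by (simp add: h_def inner_simps)
  then show ?thesis by (simp add: h_def)
qed

section \<open>Inversion of the gradient of a Legendre function\<close>

lemma inv_subdiff_unique:
  assumes f: "f \<in> Gamma0" and leg: "legendre f"
    and x: "x \<in> inv_subdiff f u" and z: "z \<in> inv_subdiff f u"
  shows "x = z"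
proof (rule ccontr)
  assume "x \<noteq> z"
  have dom: "dom_subdiff f = interior (edom f)"
    using leg by (simp add: legendre_def essentially_smooth_def)
  \<comment> \<open>\<open>dom_subdiff f\<close> is the interior of the convex set
    \<open>edom f\<close>, hence itself a convex set to which essential strict convexity
    applies.\<close>
  then have strict: "strictly_convex_on (dom_subdiff f) f"
    using leg convex_interior[OF convex_edom[OF f]]
    by (simp add: legendre_def essentially_strictly_convex_def)
  have ux: "u \<in> subdiff f x" and uz: "u \<in> subdiff f z"
    using x z by (auto simp: inv_subdiff_def)
  then have "x \<in> dom_subdiff f" "z \<in> dom_subdiff f" by (auto simp: dom_subdiff_def)
  then have less: "f ((1 - 1/2) *\<^sub>R x + (1/2) *\<^sub>R z) < ereal (1 - 1/2) * f x + ereal (1/2) * f z"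
    using \<open>x \<noteq> z\<close> by (intro strict[unfolded strictly_convex_on_def, rule_format]) auto
  \<comment> \<open>At the midpoint \<open>w\<close>, strict convexity puts \<open>f\<close> below
    the mean of \<open>f x\<close> and \<open>f z\<close>, while the shared subgradient
    \<open>u\<close> keeps it at least there.\<close>
  define w where "w = (1 - 1/2) *\<^sub>R x + (1/2) *\<^sub>R z"
  obtain a where a: "f x = ereal a" "\<And>z. ereal (a + (z - x) \<bullet> u) \<le> f z"
    using subdiffE[OF f ux] by blast
  obtain b where b: "f z = ereal b" "\<And>x. ereal (b + (x - z) \<bullet> u) \<le> f x"
    using subdiffE[OF f uz] by blast
  have "b + (x - z) \<bullet> u \<le> a" using b(2)[of x] a(1) by simp
  then have "b - a \<le> (z - x) \<bullet> u" by (simp add: inner_simps)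
  moreover have "(w - x) \<bullet> u = (z - x) \<bullet> u / 2" by (simp add: w_def inner_simps field_simps)
  ultimately have "(a + b) / 2 \<le> a + (w - x) \<bullet> u" by (simp add: field_simps)
  also have "ereal (a + (w - x) \<bullet> u) \<le> f w" by (rule a)
  also have "f w < ereal ((a + b) / 2)" using less unfolding w_def[symmetric] a(1) b(1) by (simp add: field_simps)
  finally show False by simp
qed

lemma legendre_has_gateaux_gradient:
  assumes "legendre f" "x \<in> interior (edom f)"
  shows "has_gateaux_gradient f x (grad f x)"
proof -
  obtain g where "has_gateaux_gradient f x g"
    using assms unfolding legendre_def essentially_smooth_def by blast
  then show ?thesis using grad_eqI by metis
qed

text \<open>The relation \<open>u \<in> subdiff f x\<close> links both gradients: the only
  subgradient is \<open>grad f x\<close>, local boundedness makes \<open>u\<close> interior, and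
  uniqueness of the minimizer identifies the gradient of the conjugate.\<close>

lemma legendre_inv_subdiff:
  assumes f: "f \<in> Gamma0" and leg: "legendre f" and x: "x \<in> inv_subdiff f u"
  shows "x \<in> interior (edom f)" "grad f x = u"
    "u \<in> interior (edom (fenchel_conj f))" "grad (fenchel_conj f) u = x"
proof -
  have u: "u \<in> subdiff f x" using x by (simp add: inv_subdiff_def)
  then have "x \<in> dom_subdiff f" by (auto simp: dom_subdiff_def)
  then show int: "x \<in> interior (edom f)"
    using leg by (simp add: legendre_def essentially_smooth_def)
  show "grad f x = u"
    using subdiff_eq_gateaux_gradient[OF f legendre_has_gateaux_gradient[OF leg int] u] by simp
  obtain e where e: "e > 0" "bounded (\<Union>v\<in>ball u e. inv_subdiff f v)"
    using leg x unfolding legendre_def essentially_strictly_convex_def by blast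
  show conj_int: "u \<in> interior (edom (fenchel_conj f))"
    by (rule interior_edom_conj_if_locally_bounded[OF f x e])
  have single: "inv_subdiff f u = {x}" using inv_subdiff_unique[OF f leg] x by blast
  show "grad (fenchel_conj f) u = x"
    by (rule grad_eqI[OF fenchel_conj_has_gateaux_gradient[OF f conj_int single e]])
qed

lemma legendre_grad_conj_grad:
  assumes f: "f \<in> Gamma0" and leg: "legendre f" and x: "x \<in> interior (edom f)"
  shows "grad f x \<in> interior (edom (fenchel_conj f))" "grad (fenchel_conj f) (grad f x) = x"
proof -
  have "x \<in> inv_subdiff f (grad f x)"
    using gateaux_gradient_in_subdiff[OF f legendre_has_gateaux_gradient[OF leg x]]
    by (simp add: inv_subdiff_def)
  then show "grad f x \<in> interior (edom (fenchel_conj f))" "grad (fenchel_conj f) (grad f x) = x"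
    using legendre_inv_subdiff[OF f leg] by blast+
qed

lemma legendre_grad_grad_conj:
  assumes f: "f \<in> Gamma0" and leg: "legendre f" and u: "u \<in> interior (edom (fenchel_conj f))"
  shows "grad (fenchel_conj f) u \<in> interior (edom f)" "grad f (grad (fenchel_conj f) u) = u"
proof -
  obtain x where "x \<in> inv_subdiff f u" using inv_subdiff_nonempty[OF f u] by blast
  then show "grad (fenchel_conj f) u \<in> interior (edom f)" "grad f (grad (fenchel_conj f) u) = u"
    using legendre_inv_subdiff[OF f leg] by metis+
qed

section \<open>Bregman equidistance and projections onto affine hulls\<close>

lemma grad_conj_image_iff:
  assumes f: "f \<in> Gamma0" and leg: "legendre f"
  shows "x \<in> grad_conj_image f C \<longleftrightarrow> x \<in> interior (edom f) \<and> grad f x \<in> C"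
proof
  assume "x \<in> grad_conj_image f C"
  then obtain u where "x = grad (fenchel_conj f) u" "u \<in> C" "u \<in> interior (edom (fenchel_conj f))"
    by (auto simp: grad_conj_image_def)
  then show "x \<in> interior (edom f) \<and> grad f x \<in> C"
    using legendre_grad_grad_conj[OF f leg] by simp
next
  assume "x \<in> interior (edom f) \<and> grad f x \<in> C"
  then show "x \<in> grad_conj_image f C"
    unfolding grad_conj_image_def using legendre_grad_conj_grad[OF f leg] by (metis IntI image_eqI)
qed

lemma forward_equidistant_iff:
  assumes f: "f \<in> Gamma0" and S: "S \<subseteq> edom f"
  shows "y \<in> forward_equidistant f S \<longleftrightarrow> y \<in> interior (edom f) \<and>
    (\<forall>a\<in>S. \<forall>b\<in>S. grad f y \<bullet> (a - b) = real_of_ereal (f a) - real_of_ereal (f b))"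
proof (cases "y \<in> interior (edom f)")
  case True
  have "bregman f a y = bregman f b y \<longleftrightarrow>
      grad f y \<bullet> (a - b) = real_of_ereal (f a) - real_of_ereal (f b)" if "a \<in> S" "b \<in> S" for a b
  proof -
    have "a \<in> edom f" "b \<in> edom f" "y \<in> edom f" using S that True interior_subset by blast+
    then obtain r s t where "f a = ereal r" "f b = ereal s" "f y = ereal t"
      using Gamma0_finite[OF f] by metis
    then show ?thesis using True by (auto simp: bregman_def inner_diff_right)
  qed
  then show ?thesis using True unfolding forward_equidistant_def by blast
qed (simp add: forward_equidistant_def)

text \<open>The right-hand sides of the equidistance equations involve only \<open>f\<close> on
  \<open>S\<close>, so subtracting those for \<open>y\<close> leaves homogeneous equations; by
  linearity the differences from the single point \<open>a\<close> suffice.\<close>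

lemma forward_equidistant_iff_orthogonal:
  assumes f: "f \<in> Gamma0" and S: "S \<subseteq> edom f" and y: "y \<in> forward_equidistant f S"
    and a: "a \<in> S"
  shows "x \<in> forward_equidistant f S \<longleftrightarrow>
    x \<in> interior (edom f) \<and> grad f x - grad f y \<in> orthogonal_comp (span ((\<lambda>b. b - a) ` S))"
proof -
  let ?w = "grad f x - grad f y"
  have iff: "grad f x \<bullet> (b - c) = real_of_ereal (f b) - real_of_ereal (f c) \<longleftrightarrow> ?w \<bullet> (b - c) = 0"
    if "b \<in> S" "c \<in> S" for b c
  proof -
    have "grad f y \<bullet> (b - c) = real_of_ereal (f b) - real_of_ereal (f c)"
      using y that unfolding forward_equidistant_iff[OF f S] by blast
    then show ?thesis by (simp add: inner_diff_left[of "grad f x"])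
  qed
  have "(\<forall>b\<in>S. \<forall>c\<in>S. grad f x \<bullet> (b - c) = real_of_ereal (f b) - real_of_ereal (f c)) \<longleftrightarrow>
      (\<forall>b\<in>S. \<forall>c\<in>S. ?w \<bullet> (b - c) = 0)"
    by (intro ball_cong refl iff)
  also have "\<dots> \<longleftrightarrow> (\<forall>b\<in>S. ?w \<bullet> (b - a) = 0)"
  proof (intro iffI ballI)
    fix b c assume *: "\<forall>b\<in>S. ?w \<bullet> (b - a) = 0" and "b \<in> S" "c \<in> S"
    then have "?w \<bullet> (b - a) - ?w \<bullet> (c - a) = 0" by simp
    then show "?w \<bullet> (b - c) = 0" by (simp add: inner_diff_right)
  qed (use a in blast)
  also have "\<dots> \<longleftrightarrow> (\<forall>z\<in>span ((\<lambda>b. b - a) ` S). orthogonal z ?w)"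
  proof
    assume *: "\<forall>b\<in>S. ?w \<bullet> (b - a) = 0"
    show "\<forall>z\<in>span ((\<lambda>b. b - a) ` S). orthogonal z ?w"
    proof
      fix z assume "z \<in> span ((\<lambda>b. b - a) ` S)"
      then have "?w \<bullet> z = 0"
      proof (induction rule: span_induct_alt)
        case (step c u v)
        then show ?case using * by (auto simp: inner_add_right)
      qed simp
      then show "orthogonal z ?w" by (simp add: orthogonal_def inner_commute)
    qed
  next
    assume "\<forall>z\<in>span ((\<lambda>b. b - a) ` S). orthogonal z ?w"
    then show "\<forall>b\<in>S. ?w \<bullet> (b - a) = 0"
      by (auto simp: orthogonal_def inner_commute span_base)
  qed
  finally show ?thesis
    unfolding forward_equidistant_iff[OF f S] orthogonal_comp_def by simp
qed

text \<open>A Gram-Schmidt step: \<open>b - b'\<close> is orthogonal to \<open>span B\<close>, and a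
  multiple of it corrects \<open>c\<close>. The induction hypothesis is applied to \<open>b\<close>
  as well as to \<open>x\<close>.\<close>

lemma span_orthogonal_projection_exists:
  fixes x :: "'a::real_inner"
  assumes "finite B"
  shows "\<exists>c\<in>span B. \<forall>z\<in>span B. (x - c) \<bullet> z = 0"
  using assms
proof (induction B arbitrary: x)
  case (insert b B)
  obtain b' where b': "b' \<in> span B" "\<And>z. z \<in> span B \<Longrightarrow> (b - b') \<bullet> z = 0"
    using insert.IH[of b] by blast
  obtain c where c: "c \<in> span B" "\<And>z. z \<in> span B \<Longrightarrow> (x - c) \<bullet> z = 0"
    using insert.IH[of x] by blast
  \<comment> \<open>If \<open>b = b'\<close>, division by zero yields \<open>k = 0\<close>, harmless
    because the new direction vanishes.\<close>
  define k where "k = ((x - c) \<bullet> (b - b')) / ((b - b') \<bullet> (b - b'))"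
  define d where "d = c + k *\<^sub>R (b - b')"
  have sub: "span B \<subseteq> span (insert b B)" by (intro span_mono) auto
  have "d \<in> span (insert b B)"
    unfolding d_def using b' c sub by (intro span_add span_scale span_diff) (auto intro: span_base)
  have d: "(x - d) \<bullet> z = 0" if "z \<in> span B" for z
  proof -
    have "(x - d) \<bullet> z = (x - c) \<bullet> z - k * ((b - b') \<bullet> z)"
      unfolding d_def by (simp add: inner_simps algebra_simps)
    then show ?thesis using c(2)[OF that] b'(2)[OF that] by simp
  qed
  have "(x - d) \<bullet> (b - b') = (x - c) \<bullet> (b - b') - k * ((b - b') \<bullet> (b - b'))"
    unfolding d_def by (simp add: inner_diff_left inner_add_left algebra_simps)
  also have "\<dots> = 0" by (cases "b = b'") (auto simp: k_def)
  finally have db: "(x - d) \<bullet> b = 0" using d[OF b'(1)] by (simp add: inner_diff_right)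
  have "(x - d) \<bullet> z = 0" if "z \<in> span (insert b B)" for z
    using that
  proof (induction rule: span_induct_alt)
    case (step r u v)
    then show ?case using db d[of u] by (auto simp: inner_add_right span_base)
  qed simp
  then show ?case using \<open>d \<in> span (insert b B)\<close> by blast
qed simp

text \<open>Pythagoras gives minimality and also the uniqueness that the definite description in
  \<open>hilbert_proj\<close> requires.\<close>

lemma hilbert_proj_translate_eqI:
  assumes M: "subspace M" and c: "c \<in> (+) a ` M" and orth: "\<And>z. z \<in> M \<Longrightarrow> (x - c) \<bullet> z = 0"
  shows "hilbert_proj ((+) a ` M) x = c"
proof -
  have pyth: "(dist x z)\<^sup>2 = (dist x c)\<^sup>2 + (norm (c - z))\<^sup>2" if "z \<in> (+) a ` M" for z
  proof -
    have "c - z \<in> M" using c that M by (auto simp: subspace_diff)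
    then have "(x - c) \<bullet> (c - z) = 0" by (rule orth)
    moreover have "(x - z) \<bullet> (x - z) = (x - c) \<bullet> (x - c) + 2 * ((x - c) \<bullet> (c - z)) + (c - z) \<bullet> (c - z)"
      by (simp add: inner_diff_left inner_diff_right inner_commute)
    ultimately show ?thesis by (simp add: dist_norm power2_norm_eq_inner)
  qed
  show ?thesis
    unfolding hilbert_proj_def
  proof (rule the_equality)
    have "dist x c \<le> dist x z" if "z \<in> (+) a ` M" for z
      by (rule power2_le_imp_le) (simp_all add: pyth[OF that])
    then show "c \<in> (+) a ` M \<and> (\<forall>z\<in>(+) a ` M. dist x c \<le> dist x z)" using c by blast
    fix c' assume c': "c' \<in> (+) a ` M \<and> (\<forall>z\<in>(+) a ` M. dist x c' \<le> dist x z)"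
    then have "dist x c' \<le> dist x c" using c by blast
    then have "(dist x c')\<^sup>2 \<le> (dist x c)\<^sup>2" by (intro power_mono) auto
    then show "c' = c" using pyth[of c'] c' by simp
  qed
qed

theorem theorem4p10:
  fixes f :: "'a::{real_inner,complete_space} \<Rightarrow> ereal"
    and m :: nat and p :: "nat \<Rightarrow> 'a" and S M :: "'a set" and y :: 'a
  assumes "f \<in> Gamma0" and "legendre f"
    and "m \<ge> 1"
    and "S = p ` {0..m}" and "S \<subseteq> edom f"
    and "forward_equidistant f S \<noteq> {}" and "y \<in> forward_equidistant f S"
    and "M = span ((\<lambda>i. p i - p 0) ` {1..m})"
  shows "forward_pseudo_circumcenters f S =
           grad_conj_image f (affine hull S) \<inter> interior (edom f) \<inter>
           grad_conj_image f ((\<lambda>v. grad f y + v) ` orthogonal_comp M) \<and>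
         (hilbert_proj (affine hull S) (grad f y) \<in> interior (edom (fenchel_conj f)) \<longrightarrow>
           forward_pseudo_circumcenters f S =
             {grad (fenchel_conj f) (hilbert_proj (affine hull S) (grad f y))}) \<and>
         (affine hull S \<subseteq> interior (edom (fenchel_conj f)) \<or> edom (fenchel_conj f) = UNIV \<longrightarrow>
           hilbert_proj (affine hull S) (grad f y) \<in> interior (edom (fenchel_conj f)))"
proof -
  note f = assms(1) and leg = assms(2)
  \<comment> \<open>Index \<open>0\<close> contributes only the zero vector, which leaves the span
    unchanged.\<close>
  have "{0..m} = insert 0 {1..m}" by auto
  then have "(\<lambda>b. b - p 0) ` S = insert 0 ((\<lambda>i. p i - p 0) ` {1..m})"
    by (simp add: assms(4) image_image)
  then have M: "M = span ((\<lambda>b. b - p 0) ` S)" by (simp add: assms(8) span_insert_0)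
  have p0: "p 0 \<in> S" by (auto simp: assms(4))
  have aff: "affine hull S = (+) (p 0) ` M"
    using affine_hull_span_gen[OF hull_inc[OF p0]] by (simp add: M)
  have sub: "subspace M" by (simp add: M)
  have E: "x \<in> forward_equidistant f S \<longleftrightarrow>
      x \<in> interior (edom f) \<and> grad f x - grad f y \<in> orthogonal_comp M" for x
    unfolding M by (rule forward_equidistant_iff_orthogonal[OF f assms(5,7) p0])
  have translate: "u \<in> (\<lambda>v. grad f y + v) ` orthogonal_comp M \<longleftrightarrow> u - grad f y \<in> orthogonal_comp M" for u
    by (auto intro: image_eqI[of _ _ "u - grad f y"])
  have CC: "x \<in> forward_pseudo_circumcenters f S \<longleftrightarrow> x \<in> interior (edom f) \<and>
      grad f x \<in> affine hull S \<and> grad f x - grad f y \<in> orthogonal_comp M" for x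
    by (auto simp: forward_pseudo_circumcenters_def grad_conj_image_iff[OF f leg] E)
  \<comment> \<open>\<open>grad f y - p 0\<close> is projected onto the finitely generated
    \<open>M\<close>; translating back by \<open>p 0\<close> gives \<open>q\<close>.\<close>
  have "finite ((\<lambda>b. b - p 0) ` S)" by (simp add: assms(4))
  then obtain c where c: "c \<in> M" "\<And>z. z \<in> M \<Longrightarrow> (grad f y - p 0 - c) \<bullet> z = 0"
    using span_orthogonal_projection_exists[of _ "grad f y - p 0"] unfolding M by blast
  define q where "q = p 0 + c"
  have q_aff: "q \<in> affine hull S" using c by (auto simp: aff q_def)
  have q_orth: "(grad f y - q) \<bullet> z = 0" if "z \<in> M" for z
    using c(2)[OF that] by (simp add: q_def diff_diff_eq)
  have proj: "hilbert_proj (affine hull S) (grad f y) = q"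
    unfolding aff using sub q_aff q_orth by (intro hilbert_proj_translate_eqI) (auto simp: aff)
  have q_comp: "q - grad f y \<in> orthogonal_comp M"
    using q_orth by (auto simp: orthogonal_comp_def orthogonal_def inner_diff_left inner_diff_right inner_commute)
  \<comment> \<open>The difference of two such points lies in \<open>M\<close> and in its orthogonal
    complement.\<close>
  have q_unique: "u = q" if u: "u \<in> affine hull S" "u - grad f y \<in> orthogonal_comp M" for u
  proof -
    have "u - q \<in> M" using u(1) q_aff sub by (auto simp: aff subspace_diff)
    moreover have "(u - grad f y) - (q - grad f y) \<in> orthogonal_comp M"
      by (rule subspace_diff[OF subspace_orthogonal_comp u(2) q_comp])
    ultimately have "(u - q) \<bullet> (u - q) = 0" by (simp add: orthogonal_comp_def orthogonal_def)
    then show ?thesis by simp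
  qed
  have "forward_pseudo_circumcenters f S = {grad (fenchel_conj f) q}"
    if q: "q \<in> interior (edom (fenchel_conj f))"
  proof (intro set_eqI iffI)
    fix x assume "x \<in> forward_pseudo_circumcenters f S"
    then have "x \<in> interior (edom f)" "grad f x = q" using CC q_unique by auto
    then show "x \<in> {grad (fenchel_conj f) q}" using legendre_grad_conj_grad[OF f leg] by fastforce
  next
    fix x assume "x \<in> {grad (fenchel_conj f) q}"
    then show "x \<in> forward_pseudo_circumcenters f S"
      using CC legendre_grad_grad_conj[OF f leg q] q_aff q_comp by simp
  qed
  moreover have "forward_pseudo_circumcenters f S =
           grad_conj_image f (affine hull S) \<inter> interior (edom f) \<inter>
           grad_conj_image f ((\<lambda>v. grad f y + v) ` orthogonal_comp M)"
    by (auto simp: CC grad_conj_image_iff[OF f leg] translate)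
  ultimately show ?thesis using q_aff by (auto simp: proj)
qed

end
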